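(* Let $\Omega\subseteq\mathbb{R}^n$ be an open set, let $1\le p<\infty$, and let $w$ be a weight on $\Omega$. If the embedding $W^{1,p}(\Omega,w)\to L^p(\Omega,w)$ is compact, then for every $\lambda>0$ and for every tesselation $T$ of $\mathbb{R}^n$ by $n$-cubes of fixed edge $h>0$, $T$ has only finitely many $(\lambda,w)$-fat cubes (with respect to $\Omega$).
   Context: A weight on an open set $\Omega\subseteq\mathbb{R}^n$ is a real-valued measurable function $w$ on $\Omega$ that is a.e. positive and finite. Standing assumption on $w$: if $p>1$, then $w^{-1/(p-1)}\in L^1_{\mathrm{loc}}(\Omega)$; if $p=1$, then $\operatorname{ess\,sup}_{x\in B}\frac1{w(x)}<+\infty$ for every ball $B\subset\Omega$. (Under this assumption $L^p(\Omega,w)\subseteq L^1_{\mathrm{loc}}(\Omega)$.) $L^p(\Omega,w)$ is the space of measurable $u$ with $\|u\|_{L^p(\Omega,w)}=\left(\int_\Omega |u(x)|^p w(x)\,dx\right)^{1/p}<+\infty$. $W^{1,p}(\Omega,w)$ is the space of $u\in L^p(\Omega,w)$ whose first-order distributional derivatives belong to $L^p(\Omega,w)$, with norm $\left(\int_\Omega |u|^p w\,dx+\int_\Omega|\nabla u|^p w\,dx\right)^{1/p}$. For a Lebesgue measurable set $U$, $\mu_w(U)=\int_U w(x)\,dx$. Let $T$ be a tesselation of $\mathbb{R}^n$ by $n$-cubes of edge $h$. For $H\in T$, $N(H)$ denotes the cube of side $3h$ concentric with $H$ and having faces parallel to those of $H$, and $F(H):=N(H)\setminus H$ is the fringe of $H$.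 For $\lambda>0$, the cube $H\in T$ is called $(\lambda,w)$-fat (with respect to $\Omega$) if $\mu_w(H\cap\Omega)>\lambda\,\mu_w(F(H)\cap\Omega)$.
   Formalization: Only fat cubes H with finite mass μ_w(H∩Ω) < ∞ are counted; without this the claim fails, since a weight that is not locally integrable can give a compact embedding with infinitely many fat cubes of infinite mass. *)

theory Defs
  imports "HOL-Analysis.Analysis" "HOL-Probability.Essential_Supremum"
begin

section \<open>Weights\<close>

definition locally_integrable :: "(real^'n) set \<Rightarrow> (real^'n \<Rightarrow> real) \<Rightarrow> bool" where
  "locally_integrable \<Omega> f \<longleftrightarrow>
     f \<in> borel_measurable (lebesgue_on \<Omega>) \<and>
     (\<forall>K. compact K \<and> K \<subseteq> \<Omega> \<longrightarrow> integrable (lebesgue_on K) f)"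

text \<open>Functions on \<open>\<Omega>\<close> are total functions whose values outside \<open>\<Omega>\<close> are never used.\<close>

definition weight :: "(real^'n) set \<Rightarrow> (real^'n \<Rightarrow> real) \<Rightarrow> bool" where
  "weight \<Omega> w \<longleftrightarrow>
     w \<in> borel_measurable (lebesgue_on \<Omega>) \<and> (AE x in lebesgue_on \<Omega>. 0 < w x)"

text \<open>The standing assumption relating a weight to the exponent \<open>p\<close>; it ensures that
  \<open>L\<^sup>p(\<Omega>,w) \<subseteq> L\<^sup>1\<^sub>l\<^sub>o\<^sub>c(\<Omega>)\<close>.\<close>

definition admissible_weight :: "(real^'n) set \<Rightarrow> real \<Rightarrow> (real^'n \<Rightarrow> real) \<Rightarrow> bool" where
  "admissible_weight \<Omega> p w \<longleftrightarrow>
     weight \<Omega> w \<and>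
     (p > 1 \<longrightarrow> locally_integrable \<Omega> (\<lambda>x. w x powr (- 1 / (p - 1)))) \<and>
     (p = 1 \<longrightarrow> (\<forall>x r. 0 < r \<and> ball x r \<subseteq> \<Omega> \<longrightarrow>
        esssup (lebesgue_on (ball x r)) (\<lambda>y. ereal (1 / w y)) < \<infinity>))"

text \<open>The measure \<open>\<mu>\<^sub>w\<close>. It may take the value \<open>\<infinity>\<close>, even on bounded sets, because a weight
  is not required to be locally integrable.\<close>

definition weighted_measure :: "(real^'n \<Rightarrow> real) \<Rightarrow> (real^'n) set \<Rightarrow> ennreal" where
  "weighted_measure w U = (\<integral>\<^sup>+x\<in>U. ennreal (w x) \<partial>lebesgue)"


section \<open>Weighted Lebesgue and Sobolev spaces\<close>

definition Lp_space :: "(real^'n) set \<Rightarrow> real \<Rightarrow> (real^'n \<Rightarrow> real) \<Rightarrow> (real^'n \<Rightarrow> real) set" where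
  "Lp_space \<Omega> p w =
     {u. u \<in> borel_measurable (lebesgue_on \<Omega>) \<and>
         integrable (lebesgue_on \<Omega>) (\<lambda>x. \<bar>u x\<bar> powr p * w x)}"

definition Lp_norm :: "(real^'n) set \<Rightarrow> real \<Rightarrow> (real^'n \<Rightarrow> real) \<Rightarrow> (real^'n \<Rightarrow> real) \<Rightarrow> real" where
  "Lp_norm \<Omega> p w u = (LINT x|lebesgue_on \<Omega>. \<bar>u x\<bar> powr p * w x) powr (1 / p)"

definition partial_deriv :: "'n \<Rightarrow> (real^'n \<Rightarrow> real) \<Rightarrow> real^'n \<Rightarrow> real" where
  "partial_deriv i f x = frechet_derivative f (at x) (axis i 1)"

fun C_k :: "nat \<Rightarrow> (real^'n \<Rightarrow> real) \<Rightarrow> bool" where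
  "C_k 0 f \<longleftrightarrow> continuous_on UNIV f"
| "C_k (Suc k) f \<longleftrightarrow> (\<forall>x. f differentiable (at x)) \<and> (\<forall>i. C_k k (partial_deriv i f))"

definition test_function :: "(real^'n) set \<Rightarrow> (real^'n \<Rightarrow> real) \<Rightarrow> bool" where
  "test_function \<Omega> \<phi> \<longleftrightarrow>
     (\<forall>k. C_k k \<phi>) \<and> compact (closure {x. \<phi> x \<noteq> 0}) \<and> closure {x. \<phi> x \<noteq> 0} \<subseteq> \<Omega>"

definition has_weak_gradient ::
    "(real^'n) set \<Rightarrow> (real^'n \<Rightarrow> real) \<Rightarrow> (real^'n \<Rightarrow> real^'n) \<Rightarrow> bool" where
  "has_weak_gradient \<Omega> u g \<longleftrightarrow>
     locally_integrable \<Omega> u \<and>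
     (\<forall>i. locally_integrable \<Omega> (\<lambda>x. g x $ i)) \<and>
     (\<forall>\<phi> i. test_function \<Omega> \<phi> \<longrightarrow>
        (LINT x|lebesgue_on \<Omega>. u x * partial_deriv i \<phi> x) =
        - (LINT x|lebesgue_on \<Omega>. g x $ i * \<phi> x))"

definition sobolev_space ::
    "(real^'n) set \<Rightarrow> real \<Rightarrow> (real^'n \<Rightarrow> real) \<Rightarrow> (real^'n \<Rightarrow> real) set" where
  "sobolev_space \<Omega> p w =
     {u \<in> Lp_space \<Omega> p w.
        \<exists>g. has_weak_gradient \<Omega> u g \<and> (\<forall>i. (\<lambda>x. g x $ i) \<in> Lp_space \<Omega> p w)}"

text \<open>The norm of \<open>W\<^sup>1\<^sup>,\<^sup>p(\<Omega>,w)\<close> as a relation between \<open>u\<close> and the value of its norm. Since the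
  weak gradient is unique almost everywhere, every \<open>u\<close> in the space has exactly one norm.\<close>

definition has_sobolev_norm ::
    "(real^'n) set \<Rightarrow> real \<Rightarrow> (real^'n \<Rightarrow> real) \<Rightarrow> (real^'n \<Rightarrow> real) \<Rightarrow> real \<Rightarrow> bool" where
  "has_sobolev_norm \<Omega> p w u N \<longleftrightarrow>
     (\<exists>g. has_weak_gradient \<Omega> u g \<and>
        N = ((LINT x|lebesgue_on \<Omega>. \<bar>u x\<bar> powr p * w x) +
             (LINT x|lebesgue_on \<Omega>. norm (g x) powr p * w x)) powr (1 / p))"

text \<open>Compactness of the embedding \<open>W\<^sup>1\<^sup>,\<^sup>p(\<Omega>,w) \<rightarrow> L\<^sup>p(\<Omega>,w)\<close>: every norm-bounded sequence in
  \<open>W\<^sup>1\<^sup>,\<^sup>p(\<Omega>,w)\<close> has a subsequence that converges in \<open>L\<^sup>p(\<Omega>,w)\<close>.\<close>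

definition compact_sobolev_embedding ::
    "(real^'n) set \<Rightarrow> real \<Rightarrow> (real^'n \<Rightarrow> real) \<Rightarrow> bool" where
  "compact_sobolev_embedding \<Omega> p w \<longleftrightarrow>
     (\<forall>(u :: nat \<Rightarrow> real^'n \<Rightarrow> real) M.
        (\<forall>k. u k \<in> sobolev_space \<Omega> p w \<and> (\<exists>N\<le>M. has_sobolev_norm \<Omega> p w (u k) N)) \<longrightarrow>
        (\<exists>v\<in>Lp_space \<Omega> p w. \<exists>r :: nat \<Rightarrow> nat. strict_mono r \<and>
           (\<lambda>k. Lp_norm \<Omega> p w (\<lambda>x. u (r k) x - v x)) \<longlonglongrightarrow> 0))"


section \<open>Tesselations by cubes\<close>

text \<open>The closed cube with centre \<open>c\<close>, edge \<open>s\<close>, and edge directions given by the columns of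
  the orthogonal matrix \<open>Q\<close>.\<close>

definition cube :: "real^'n \<Rightarrow> real^'n^'n \<Rightarrow> real \<Rightarrow> (real^'n) set" where
  "cube c Q s = {c + Q *v y | y. \<forall>i. \<bar>y $ i\<bar> \<le> s / 2}"

text \<open>Cubes of a tesselation need not be axis-parallel, need not be parallel to each other,
  and need not meet face to face.\<close>

definition tesselation :: "real \<Rightarrow> (real^'n) set set \<Rightarrow> bool" where
  "tesselation h T \<longleftrightarrow>
     (\<forall>H\<in>T. \<exists>c Q. orthogonal_matrix Q \<and> H = cube c Q h) \<and>
     pairwise (\<lambda>H H'. interior H \<inter> interior H' = {}) T \<and>
     \<Union>T = UNIV"

text \<open>The concentric parallel cube of three times the edge. The description is unambiguous: a
  cube determines its centre, its edge, and its edge directions up to order and sign.\<close>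

definition cube_nbhd :: "(real^'n) set \<Rightarrow> (real^'n) set" where
  "cube_nbhd H =
     (THE N. \<exists>c Q s. 0 < s \<and> orthogonal_matrix Q \<and> H = cube c Q s \<and> N = cube c Q (3 * s))"

definition fringe :: "(real^'n) set \<Rightarrow> (real^'n) set" where
  "fringe H = cube_nbhd H - H"

text \<open>The inequality is read in \<open>[0,\<infinity>]\<close>, so a cube of infinite mass whose fringe has finite
  mass is fat for every \<open>\<lambda>\<close>.\<close>

definition fat_cube :: "(real^'n) set \<Rightarrow> real \<Rightarrow> (real^'n \<Rightarrow> real) \<Rightarrow> (real^'n) set \<Rightarrow> bool" where
  "fat_cube \<Omega> lam w H \<longleftrightarrow>
     weighted_measure w (H \<inter> \<Omega>) > ennreal lam * weighted_measure w (fringe H \<inter> \<Omega>)"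

text \<open>A compact embedding bounds the number of fat cubes only among those of finite mass. For
  \<open>n = 1\<close>, \<open>p = 2\<close>, \<open>\<Omega> = (0,\<infinity>)\<close>, take \<open>w(x) = exp(-x\<^sup>2)\<close>, multiplied by
  \<open>(\<delta>\<^sub>k/\<bar>x - 5k\<bar>)\<^sup>2\<close> where \<open>0 < \<bar>x - 5k\<bar> < \<delta>\<^sub>k = 1/(50k)\<close>, \<open>k \<ge> 1\<close>. This weight is
  admissible and, by Hardy's inequality at the points \<open>5k\<close> (where every \<open>u\<close> in the Sobolev
  space vanishes), the embedding is compact; yet each of the intervals \<open>[5k - 1/2, 5k + 1/2]\<close>
  has infinite mass and a fringe of finite mass. Statements about fat cubes therefore carry
  the condition of finite mass explicitly.\<close>

end

theory Submission
  imports Defs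
begin

text \<open>
  A fat cube carries a fixed proportion of the mass of its enlargement. The function that is \<open>1\<close> on
  the cube and falls to \<open>0\<close> across the fringe therefore has a Sobolev norm comparable to the
  \<open>L\<^sup>p\<close> norm of its restriction to the cube, with a constant depending only on \<open>\<lambda>\<close>, \<open>h\<close> and \<open>p\<close>.
  If the mass of the cube is finite, this function can be normalized to have energy \<open>1\<close> over the
  cube (\<open>fat_cube_normalized_cutoff\<close>). Infinitely many fat cubes thus give a bounded sequence in the
  Sobolev space, each member of which has energy \<open>1\<close> over the interior of its own cube. These
  interiors are disjoint, so the energy of any fixed \<open>L\<^sup>p\<close> function over them tends to zero, and no
  subsequence can converge in \<open>L\<^sup>p\<close> (\<open>compact_embedding_no_disjoint_bumps\<close>).

  The cutoff is a function of the squared distance to the cube. Since a cube is convex, the squared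
  distance is continuously differentiable, with a gradient given by the nearest-point projection
  (\<open>has_derivative_square_dist_closest_point\<close>). The cutoff thus has a
  classical gradient of length at most \<open>4/h\<close>, and the position and directions of the cube do not
  enter this bound. The classical gradient
  is the weak one (\<open>has_weak_gradient_of_C1\<close>), because a compactly supported function with bounded
  directional derivatives has derivatives of integral zero.
\<close>

section \<open>Cubes and their threefold enlargements\<close>

lemma cube_eq_image_cbox:
  "cube c (Q :: real^'n^'n) s = (\<lambda>y. c + Q *v y) ` cbox (\<chi> i. - (s / 2)) (\<chi> i. s / 2)"
proof -
  have "cbox (\<chi> i. - (s / 2)) (\<chi> i. s / 2) = {y :: real^'n. \<forall>i. \<bar>y $ i\<bar> \<le> s / 2}"
    by (simp only: set_eq_iff mem_box_cart mem_Collect_eq abs_le_iff vec_lambda_beta minus_le_iff conj_commute) blast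
  then show ?thesis
    unfolding cube_def by (simp only:) blast
qed

lemma compact_cube: "compact (cube c Q s)"
  unfolding cube_eq_image_cbox
  by (intro compact_continuous_image continuous_intros matrix_vector_mult_linear_continuous_on compact_cbox)

lemma convex_cube: "convex (cube c Q s)"
proof -
  have "cube c Q s = (+) c ` ((*v) Q ` cbox (\<chi> i. - (s / 2)) (\<chi> i. s / 2))"
    unfolding cube_eq_image_cbox by (simp add: image_image)
  then show ?thesis
    by (simp only: convex_translation convex_linear_image matrix_vector_mul_linear convex_box)
qed

text \<open>In cube coordinates, with \<open>K = [-s/2, s/2]\<^sup>n\<close>, the identity reads \<open>K + K - K = 3K\<close>. It describes the enlarged cube in
terms of the point set \<open>cube c Q s\<close> alone, so it settles at once that the enlargement does not
depend on how the centre, the directions and the edge of the cube were chosen.\<close>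

lemma cube_triple_edge:
  "cube c Q (3 * s) = {a + b - d | a b d. a \<in> cube c Q s \<and> b \<in> cube c Q s \<and> d \<in> cube c Q s}"
    (is "_ = ?R")
proof (intro subset_antisym subsetI)
  fix x assume "x \<in> cube c Q (3 * s)"
  then obtain y where y: "x = c + Q *v y" "\<And>i. \<bar>y $ i\<bar> \<le> 3 * s / 2"
    unfolding cube_def by auto
  \<comment> \<open>A threefold enlarged coordinate vector is split as \<open>y = y/3 + y/3 - (-y/3)\<close>.\<close>
  define z where "z = (1 / 3) *\<^sub>R y"
  have bnd: "\<bar>z $ i\<bar> \<le> s / 2" for i
    using y(2)[of i] by (simp add: z_def abs_if split: if_splits)
  have "c + Q *v y' \<in> cube c Q s" if "\<And>i. \<bar>y' $ i\<bar> \<le> s / 2" for y'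
    unfolding cube_def using that by blast
  from this[of z] this[of "- z"] bnd
  have z: "c + Q *v z \<in> cube c Q s" "c + Q *v (- z) \<in> cube c Q s"
    by simp_all
  have "y = z + z - (- z)"
    by (simp add: z_def vec_eq_iff)
  then have "Q *v y = Q *v z + Q *v z - Q *v (- z)"
    by (simp only: matrix_vector_mult_diff_distrib matrix_vector_right_distrib)
  then have "x = (c + Q *v z) + (c + Q *v z) - (c + Q *v (- z))"
    unfolding y(1) by (simp only: algebra_simps)
  with z show "x \<in> ?R" by blast
next
  fix x assume "x \<in> ?R"
  then obtain a b d where x: "x = a + b - d" and
    "a \<in> cube c Q s" "b \<in> cube c Q s" "d \<in> cube c Q s" by blast
  then obtain a' b' d' where
    "a = c + Q *v a'" "\<And>i. \<bar>a' $ i\<bar> \<le> s / 2"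
    "b = c + Q *v b'" "\<And>i. \<bar>b' $ i\<bar> \<le> s / 2"
    "d = c + Q *v d'" "\<And>i. \<bar>d' $ i\<bar> \<le> s / 2"
    unfolding cube_def by auto
  moreover have "\<bar>(a' + b' - d') $ i\<bar> \<le> 3 * s / 2" for i
    using calculation(2)[of i] calculation(4)[of i] calculation(6)[of i]
    unfolding vector_add_component vector_minus_component by linarith
  ultimately show "x \<in> cube c Q (3 * s)"
    unfolding cube_def x
    by (auto intro!: exI[of _ "a' + b' - d'"]
      simp: matrix_vector_mult_diff_distrib matrix_vector_right_distrib)
qed

lemma cube_nbhd_cube:
  assumes "0 < s" "orthogonal_matrix Q"
  shows "cube_nbhd (cube c Q s) = cube c Q (3 * s)"
  unfolding cube_nbhd_def
proof (rule the_equality)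
  show "\<exists>c' Q' s'. 0 < s' \<and> orthogonal_matrix Q' \<and> cube c Q s = cube c' Q' s' \<and>
      cube c Q (3 * s) = cube c' Q' (3 * s')"
    using assms by blast
next
  fix N assume "\<exists>c' Q' s'. 0 < s' \<and> orthogonal_matrix Q' \<and> cube c Q s = cube c' Q' s' \<and>
      N = cube c' Q' (3 * s')"
  then obtain c' Q' s' where "cube c Q s = cube c' Q' s'" "N = cube c' Q' (3 * s')"
    by blast
  then show "N = cube c Q (3 * s)"
    by (simp only: cube_triple_edge)
qed

text \<open>An orthogonal matrix preserves Euclidean length, and each coordinate of a vector is bounded by its
length; a displacement of length at most \<open>s\<close> thus changes each cube coordinate by at most \<open>s\<close>.
This is what places the support of the cutoff of a cube inside its neighbourhood.\<close>

lemma cube_nbhd_contains_collar: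
  assumes "orthogonal_matrix Q" "a \<in> cube c Q s" "dist x a \<le> s"
  shows "x \<in> cube c Q (3 * s)"
proof -
  obtain y where y: "a = c + Q *v y" "\<And>i. \<bar>y $ i\<bar> \<le> s / 2"
    using assms(2) unfolding cube_def by auto
  define z where "z = transpose Q *v (x - a)"
  have "Q *v z = x - a"
    using assms(1) by (simp add: z_def matrix_vector_mul_assoc orthogonal_matrix_def
        del: vector_transpose_matrix transpose_matrix_vector)
  then have x: "x = c + Q *v (y + z)"
    by (simp add: y(1) matrix_vector_right_distrib)
  have "norm z = norm (x - a)"
    using assms(1) unfolding z_def
    by (metis orthogonal_matrix_transpose orthogonal_transformation_matrix orthogonal_transformation_norm
        matrix_of_matrix_vector_mul matrix_vector_mul_linear)
  then have z_le: "\<bar>z $ i\<bar> \<le> s" for i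
    using assms(3) component_le_norm_cart[of z i] by (simp add: dist_norm)
  have "\<bar>(y + z) $ i\<bar> \<le> 3 * s / 2" for i
    using y(2)[of i] z_le[of i] unfolding vector_add_component by linarith
  with x show ?thesis
    unfolding cube_def by blast
qed


section \<open>A continuously differentiable cutoff around a convex set\<close>

lemma has_derivative_of_quadratic_error:
  fixes f :: "'a::real_normed_vector \<Rightarrow> 'b::real_normed_vector"
  assumes "bounded_linear f'" and "\<And>y. norm (f y - f x - f' (y - x)) \<le> C * (norm (y - x))\<^sup>2"
  shows "(f has_derivative f') (at x)"
proof (rule has_derivativeI_sandwich[where e = 1 and H = "\<lambda>y. C * norm (y - x)"])
  show "norm (f y - f x - f' (y - x)) / norm (y - x) \<le> C * norm (y - x)" if "y \<noteq> x" for y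
    using assms(2)[of y] that by (simp add: divide_simps power2_eq_square mult.assoc)
  show "((\<lambda>y. C * norm (y - x)) \<longlongrightarrow> 0) (at x)"
    by (rule tendsto_eq_intros refl | simp)+
qed (use assms(1) in simp_all)

text \<open>Write \<open>P\<close> for the projection onto \<open>S\<close>. The distance of \<open>y\<close> to \<open>S\<close> is at most \<open>\<bar>y - P x\<bar>\<close>, which
bounds the increment of the squared distance from above by its linear part plus \<open>\<bar>y - x\<bar>\<^sup>2\<close>.
Exchanging \<open>x\<close> and \<open>y\<close> gives a lower bound, with the gradient taken at \<open>y\<close>; since \<open>P\<close> does not
increase distances, moving the gradient back to \<open>x\<close> keeps the error within \<open>\<bar>y - x\<bar>\<^sup>2\<close>.\<close>

lemma has_derivative_square_dist_closest_point:
  fixes S :: "'a::euclidean_space set"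
  assumes "convex S" "closed S" "S \<noteq> {}"
  shows "((\<lambda>x. (norm (x - closest_point S x))\<^sup>2) has_derivative
          (\<lambda>v. 2 * ((x - closest_point S x) \<bullet> v))) (at x)"
proof (rule has_derivative_of_quadratic_error[where C = 1])
  show "bounded_linear (\<lambda>v. 2 * ((x - closest_point S x) \<bullet> v))"
    by (intro bounded_linear_const_mult bounded_linear_inner_right)
next
  fix y
  let ?P = "closest_point S"
  have near: "(norm (a - ?P a))\<^sup>2 \<le> (norm (a - ?P b))\<^sup>2" for a b
    using closest_point_le[OF assms(2) closest_point_in_set[OF assms(2,3)], of a b]
    by (simp add: dist_norm)
  have "(?P y - ?P x) \<bullet> (y - x) \<le> norm (?P y - ?P x) * norm (y - x)"
    by (rule norm_cauchy_schwarz)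
  also have "\<dots> \<le> norm (y - x) * norm (y - x)"
    using closest_point_lipschitz[OF assms, of y x] by (intro mult_right_mono) (auto simp: dist_norm)
  finally have "(?P y - ?P x) \<bullet> (y - x) \<le> (y - x) \<bullet> (y - x)"
    by (simp add: dot_square_norm power2_eq_square)
  with near[of x y] near[of y x]
  show "norm ((norm (y - ?P y))\<^sup>2 - (norm (x - ?P x))\<^sup>2 - 2 * ((x - ?P x) \<bullet> (y - x)))
      \<le> 1 * (norm (y - x))\<^sup>2"
    unfolding power2_norm_eq_inner real_norm_def
    by (simp add: algebra_simps inner_commute)
qed

text \<open>The positive part of a real number is its distance to the half-line of nonpositive numbers, so
this is the one-dimensional case of the preceding lemma.\<close>

lemma has_real_derivative_square_pos_part:
  "((\<lambda>t. (max 0 t)\<^sup>2) has_real_derivative 2 * max 0 t) (at t)" for t :: real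
proof -
  have "min t 0 = closest_point {..0} t" for t :: real
    by (rule closest_point_unique) (auto simp: dist_real_def)
  moreover have "t - min t 0 = max 0 t" for t :: real
    by simp
  ultimately have pos_part: "t - closest_point {..0} t = max 0 t" for t :: real
    by metis
  have "((\<lambda>t. (norm (t - closest_point {..0} t))\<^sup>2) has_derivative
      (\<lambda>v. 2 * ((t - closest_point {..0} t) \<bullet> v))) (at t)"
    by (rule has_derivative_square_dist_closest_point) auto
  then show ?thesis
    unfolding pos_part has_field_derivative_def real_norm_def power2_abs
    by (rule has_derivative_eq_rhs) auto
qed

text \<open>Both squares are there for smoothness: the squared distance to a convex set and the squared
positive part are continuously differentiable, while the distance and the positive part are not.\<close>

definition cutoff :: "'a::euclidean_space set \<Rightarrow> real \<Rightarrow> 'a \<Rightarrow> real" where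
  "cutoff S h x = (max 0 (1 - (norm (x - closest_point S x))\<^sup>2 / h\<^sup>2))\<^sup>2"

definition cutoff_gradient :: "'a::euclidean_space set \<Rightarrow> real \<Rightarrow> 'a \<Rightarrow> 'a" where
  "cutoff_gradient S h x =
     (- (4 / h\<^sup>2) * max 0 (1 - (norm (x - closest_point S x))\<^sup>2 / h\<^sup>2)) *\<^sub>R (x - closest_point S x)"

lemma cutoff_has_derivative:
  fixes S :: "'a::euclidean_space set"
  assumes "convex S" "closed S" "S \<noteq> {}"
  shows "(cutoff S h has_derivative (\<lambda>v. cutoff_gradient S h x \<bullet> v)) (at x)"
proof -
  let ?t = "\<lambda>x. 1 - (norm (x - closest_point S x))\<^sup>2 / h\<^sup>2"
  have "(?t has_derivative (\<lambda>v. - (2 * ((x - closest_point S x) \<bullet> v)) / h\<^sup>2)) (at x)"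
    unfolding divide_inverse
    by (rule derivative_eq_intros has_derivative_square_dist_closest_point[OF assms] refl)+ simp
  from has_derivative_compose[OF this has_real_derivative_square_pos_part[unfolded has_field_derivative_def]]
  show ?thesis
    unfolding cutoff_def[abs_def] cutoff_gradient_def
    by (rule has_derivative_eq_rhs) (simp add: fun_eq_iff)
qed

lemma continuous_on_cutoff_gradient:
  assumes "convex S" "closed S" "S \<noteq> {}"
  shows "continuous_on UNIV (cutoff_gradient S h)"
  unfolding cutoff_gradient_def divide_inverse
  by (intro continuous_intros continuous_on_closest_point assms)

lemma cutoff_range: "0 \<le> cutoff S h x" "cutoff S h x \<le> 1"
proof -
  have "0 \<le> (norm (x - closest_point S x))\<^sup>2 / h\<^sup>2" by simp
  then have "max 0 (1 - (norm (x - closest_point S x))\<^sup>2 / h\<^sup>2) \<le> 1" by simp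
  then show "cutoff S h x \<le> 1"
    unfolding cutoff_def by (simp add: power_le_one)
qed (simp add: cutoff_def)

lemma cutoff_eq_1: "x \<in> S \<Longrightarrow> cutoff S h x = 1"
  by (simp add: cutoff_def closest_point_self)

lemma cutoff_support:
  assumes "0 < h" "h < dist x (closest_point S x)"
  shows "cutoff S h x = 0" "cutoff_gradient S h x = 0"
proof -
  have "h\<^sup>2 \<le> (norm (x - closest_point S x))\<^sup>2"
    using assms by (intro power_mono) (auto simp: dist_norm)
  then have "1 - (norm (x - closest_point S x))\<^sup>2 / h\<^sup>2 \<le> 0"
    using assms(1) by simp
  then show "cutoff S h x = 0" "cutoff_gradient S h x = 0"
    by (simp_all add: cutoff_def cutoff_gradient_def)
qed

text \<open>The gradient vanishes at distance more than \<open>h\<close> from \<open>S\<close>, and at distance \<open>d \<le> h\<close> its length is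
at most \<open>4 d / h\<^sup>2\<close>. The bound does not involve \<open>S\<close>, so it is common to all cubes of a tesselation.\<close>

lemma norm_cutoff_gradient_le:
  assumes "0 < h"
  shows "norm (cutoff_gradient S h x) \<le> 4 / h"
proof (cases "h < dist x (closest_point S x)")
  case True
  then show ?thesis using assms cutoff_support[OF assms True] by simp
next
  case False
  let ?d = "norm (x - closest_point S x)"
  have "norm (cutoff_gradient S h x) = (4 / h\<^sup>2) * max 0 (1 - ?d\<^sup>2 / h\<^sup>2) * ?d"
    by (simp add: cutoff_gradient_def abs_mult)
  also have "\<dots> \<le> (4 / h\<^sup>2) * 1 * h"
    using False by (intro mult_mono) (auto simp: dist_norm)
  also have "\<dots> = 4 / h"
    using assms by (simp add: power2_eq_square)
  finally show ?thesis .
qed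


section \<open>Classical gradients are weak gradients\<close>

lemma compact_support_continuous_integrable:
  fixes f :: "'a::euclidean_space \<Rightarrow> real"
  assumes "continuous_on UNIV f" "compact K" "\<And>x. x \<notin> K \<Longrightarrow> f x = 0"
  shows "integrable lborel f"
proof -
  have "integrable lborel (\<lambda>x. indicator K x *\<^sub>R f x)"
    using assms(1,2) by (intro borel_integrable_compact) (auto intro: continuous_on_subset)
  also have "(\<lambda>x. indicator K x *\<^sub>R f x) = f"
    using assms(3) by (auto simp: fun_eq_iff indicator_def)
  finally show ?thesis .
qed

lemma compact_support_continuous_bounded:
  fixes f :: "'a::euclidean_space \<Rightarrow> real"
  assumes "continuous_on UNIV f" "compact K" "\<And>x. x \<notin> K \<Longrightarrow> f x = 0"
  obtains B where "0 \<le> B" "\<And>x. \<bar>f x\<bar> \<le> B"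
proof -
  have "bounded (f ` K)"
    using assms by (intro compact_imp_bounded compact_continuous_image) (auto intro: continuous_on_subset)
  then obtain B where B: "\<And>x. x \<in> K \<Longrightarrow> \<bar>f x\<bar> \<le> B" by (auto simp: bounded_iff)
  show thesis
  proof (rule that[of "max B 0"])
    show "\<bar>f x\<bar> \<le> max B 0" for x
      using B[of x] assms(3)[of x] by (cases "x \<in> K") auto
  qed simp
qed

text \<open>Translation invariance makes the integral of every difference quotient of \<open>f\<close> vanish. By the mean
value theorem the quotients with increments in \<open>(0,1]\<close> are bounded by \<open>B\<close>, and they vanish outside
one bounded set, so dominated convergence passes this on to the derivative.\<close>

lemma integral_directional_derivative_eq_0:
  fixes f :: "'a::euclidean_space \<Rightarrow> real"
  assumes deriv: "\<And>x. (f has_derivative D x) (at x)"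
    and bound: "\<And>x. \<bar>D x e\<bar> \<le> B"
    and K: "compact K" "\<And>x. x \<notin> K \<Longrightarrow> f x = 0"
  shows "(LINT x|lborel. D x e) = 0"
proof -
  have cont: "continuous_on UNIV f"
    using deriv by (meson has_derivative_continuous continuous_at_imp_continuous_on)
  then have meas [measurable]: "f \<in> borel_measurable borel"
    by (rule borel_measurable_continuous_onI)
  have int_f: "integrable lborel f"
    using cont K by (rule compact_support_continuous_integrable)
  define t where "t k = inverse (real (Suc k))" for k
  define q where "q k x = (f (x + t k *\<^sub>R e) - f x) / t k" for k x
  have t: "0 < t k" "t k \<le> 1" for k
    by (auto simp: t_def inverse_eq_divide)
  have line: "((\<lambda>s. f (x + s *\<^sub>R e)) has_real_derivative D (x + s *\<^sub>R e) e) (at s)" for x s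
  proof -
    have "((\<lambda>s. x + s *\<^sub>R e) has_derivative (\<lambda>s. s *\<^sub>R e)) (at s)"
      by (auto intro!: derivative_eq_intros)
    from has_derivative_compose[OF this deriv]
    show ?thesis
      unfolding has_field_derivative_def
      by (rule has_derivative_eq_rhs)
        (simp add: fun_eq_iff linear_cmul[OF has_derivative_linear[OF deriv]])
  qed
  have lim: "(\<lambda>k. q k x) \<longlonglongrightarrow> D x e" for x
  proof -
    have "(\<lambda>s. (f (x + (0 + s) *\<^sub>R e) - f (x + 0 *\<^sub>R e)) / s) \<midarrow>0\<rightarrow> D (x + 0 *\<^sub>R e) e"
      using line[of x 0] unfolding DERIV_def .
    moreover have "filterlim t (at 0) sequentially"
      using LIMSEQ_inverse_real_of_nat t(1)
      unfolding filterlim_at t_def[abs_def] by (auto simp: less_imp_neq[THEN not_sym])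
    ultimately show ?thesis
      by (auto dest: filterlim_compose simp: q_def)
  qed
  obtain R where R: "\<And>x. x \<in> K \<Longrightarrow> norm x \<le> R"
    using compact_imp_bounded[OF K(1)] unfolding bounded_iff by blast
  let ?L = "cball (0 :: 'a) (R + norm e)"
  have dom: "norm (q k x) \<le> indicator ?L x *\<^sub>R B" for k x
  proof (cases "x \<in> ?L")
    case True
    obtain z where "f (x + t k *\<^sub>R e) - f (x + 0 *\<^sub>R e) = (t k - 0) * D (x + z *\<^sub>R e) e"
      using MVT2[OF t(1)[of k], of "\<lambda>s. f (x + s *\<^sub>R e)" "\<lambda>s. D (x + s *\<^sub>R e) e"] line by blast
    then have "q k x = D (x + z *\<^sub>R e) e"
      using t(1)[of k] by (simp add: q_def)
    with True bound show ?thesis by simp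
  next
    case False
    have "norm (t k *\<^sub>R e) \<le> norm e" "0 \<le> norm (t k *\<^sub>R e)"
      using t[of k] by (simp_all add: mult_left_le_one_le)
    moreover have "norm x \<le> norm (x + t k *\<^sub>R e) + norm (t k *\<^sub>R e)"
      by (metis add_diff_cancel_right' norm_triangle_ineq4)
    ultimately have "x \<notin> K" "x + t k *\<^sub>R e \<notin> K"
      using False R[of x] R[of "x + t k *\<^sub>R e"] unfolding mem_cball_0 by linarith+
    with False K(2) show ?thesis by (simp add: q_def)
  qed
  have shift: "(LINT x|lborel. f (x + a)) = (LINT x|lborel. f x)" "integrable lborel (\<lambda>x. f (x + a))" for a
  proof -
    have "(LINT x|distr lborel borel ((+) a). f x) = (LINT x|lborel. f (a + x))"
      by (rule integral_distr) auto
    then show "(LINT x|lborel. f (x + a)) = (LINT x|lborel. f x)"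
      by (simp add: lborel_distr_plus add.commute)
    have "integrable (distr lborel borel ((+) a)) f = integrable lborel (\<lambda>x. f (a + x))"
      by (rule integrable_distr_eq) auto
    then show "integrable lborel (\<lambda>x. f (x + a))"
      using int_f by (simp add: lborel_distr_plus add.commute)
  qed
  have zero: "(LINT x|lborel. q k x) = 0" for k
    unfolding q_def by (simp add: shift int_f)
  have "(\<lambda>k. LINT x|lborel. q k x) \<longlonglongrightarrow> (LINT x|lborel. D x e)"
  proof (rule integral_dominated_convergence[where w = "\<lambda>x. indicator ?L x *\<^sub>R B"])
    show "(\<lambda>x. D x e) \<in> borel_measurable lborel"
      by (rule borel_measurable_LIMSEQ_real[OF lim]) (simp add: q_def)
    show "integrable lborel (\<lambda>x. indicator ?L x *\<^sub>R B)"
      by (rule borel_integrable_compact) auto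
    show "q k \<in> borel_measurable lborel" for k
      unfolding q_def[abs_def] by simp
  qed (use lim dom in simp_all)
  then show ?thesis by (simp add: zero LIMSEQ_const_iff)
qed

lemma continuous_locally_integrable:
  fixes f :: "real^'n \<Rightarrow> real"
  assumes "continuous_on UNIV f"
  shows "locally_integrable \<Omega> f"
  unfolding locally_integrable_def
proof (intro conjI allI impI)
  show "f \<in> borel_measurable (lebesgue_on \<Omega>)"
    using borel_measurable_continuous_onI[OF assms]
    by (intro measurable_restrict_space1 measurable_completion) simp
next
  fix K assume "compact K \<and> K \<subseteq> \<Omega>"
  then have "integrable lborel (\<lambda>x. indicator K x *\<^sub>R f x)" "K \<in> sets lebesgue"
    using assms borel_integrable_compact[of K f] continuous_on_subset[of UNIV f K]
    by (auto intro: fmeasurableD lmeasurable_compact)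
  then show "integrable (lebesgue_on K) f"
    by (simp add: integrable_restrict_space integrable_completion)
qed

lemma integral_lebesgue_on_of_support:
  fixes f :: "'a::euclidean_space \<Rightarrow> real"
  assumes "f \<in> borel_measurable borel" "\<Omega> \<in> sets lebesgue" "\<And>x. x \<notin> \<Omega> \<Longrightarrow> f x = 0"
  shows "(LINT x|lebesgue_on \<Omega>. f x) = (LINT x|lborel. f x)"
proof -
  have "(LINT x|lebesgue_on \<Omega>. f x) = (LINT x|lebesgue. indicator \<Omega> x *\<^sub>R f x)"
    using assms(2) by (simp add: integral_restrict_space)
  also have "(\<lambda>x. indicator \<Omega> x *\<^sub>R f x) = f"
    using assms(3) by (auto simp: fun_eq_iff indicator_def)
  finally show ?thesis
    using assms(1) by (simp add: integral_completion)
qed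

text \<open>The product of \<open>f\<close> with a test function \<open>\<phi>\<close> has compact support in \<open>\<Omega>\<close>, so its partial
derivative \<open>f \<partial>\<^sub>i\<phi> + (\<partial>\<^sub>i f) \<phi>\<close> has integral zero by the preceding lemma.\<close>

lemma has_weak_gradient_of_C1:
  fixes f :: "real^'n \<Rightarrow> real"
  assumes "open \<Omega>"
    and deriv: "\<And>x. (f has_derivative (\<lambda>v. g x \<bullet> v)) (at x)"
    and cont_g: "continuous_on UNIV g"
  shows "has_weak_gradient \<Omega> f g"
  unfolding has_weak_gradient_def
proof (intro conjI allI impI)
  have cont_f: "continuous_on UNIV f"
    using deriv by (meson has_derivative_continuous continuous_at_imp_continuous_on)
  then show "locally_integrable \<Omega> f"
    by (rule continuous_locally_integrable)
  have cont_gi: "continuous_on UNIV (\<lambda>x. g x $ i)" for i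
    using cont_g by (intro continuous_intros)
  then show "locally_integrable \<Omega> (\<lambda>x. g x $ i)" for i
    by (rule continuous_locally_integrable)
  fix \<phi> i assume test: "test_function \<Omega> \<phi>"
  define K where "K = closure {x. \<phi> x \<noteq> 0}"
  have K: "compact K" "K \<subseteq> \<Omega>"
    using test by (auto simp: test_function_def K_def)
  have \<phi>0: "\<phi> x = 0" if "x \<notin> K" for x
    using that closure_subset[of "{x. \<phi> x \<noteq> 0}"] by (auto simp: K_def)
  have "C_k (Suc 0) \<phi>"
    using test unfolding test_function_def by blast
  then have deriv_\<phi>: "(\<phi> has_derivative frechet_derivative \<phi> (at x)) (at x)"
    and cont_d\<phi>: "continuous_on UNIV (partial_deriv i \<phi>)" for x
    by (auto simp: frechet_derivative_works)
  have cont_\<phi>: "continuous_on UNIV \<phi>"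
    using deriv_\<phi> by (meson has_derivative_continuous continuous_at_imp_continuous_on)
  have d\<phi>0: "partial_deriv i \<phi> x = 0" if "x \<notin> K" for x
  proof -
    have "(\<phi> has_derivative (\<lambda>_. 0)) (at x)"
    proof (rule has_derivative_transform_within_open[of "\<lambda>_. 0" _ _ _ "- K"])
      show "open (- K)" using K(1) by (simp add: compact_imp_closed open_Compl)
    qed (use that \<phi>0 in auto)
    then have "frechet_derivative \<phi> (at x) = (\<lambda>_. 0)"
      by (metis frechet_derivative_at)
    then show ?thesis by (simp add: partial_deriv_def)
  qed
  define D where "D x v = f x * frechet_derivative \<phi> (at x) v + (g x \<bullet> v) * \<phi> x" for x v
  have D_axis: "D x (axis i 1) = f x * partial_deriv i \<phi> x + g x $ i * \<phi> x" for x
    by (simp add: D_def partial_deriv_def inner_axis)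
  have cont: "continuous_on UNIV (\<lambda>x. f x * partial_deriv i \<phi> x)"
      "continuous_on UNIV (\<lambda>x. g x $ i * \<phi> x)"
    by (intro continuous_intros cont_f cont_d\<phi> cont_gi cont_\<phi>)+
  have "continuous_on UNIV (\<lambda>x. D x (axis i 1))"
    unfolding D_axis using cont by (rule continuous_on_add)
  moreover have "D x (axis i 1) = 0" if "x \<notin> K" for x
    using that \<phi>0 d\<phi>0 by (simp add: D_axis)
  ultimately obtain B where "\<And>x. \<bar>D x (axis i 1)\<bar> \<le> B"
    using K(1) compact_support_continuous_bounded by metis
  moreover have "((\<lambda>x. f x * \<phi> x) has_derivative D x) (at x)" for x
    unfolding D_def[abs_def] by (rule has_derivative_mult[OF deriv deriv_\<phi>])
  ultimately have "(LINT x|lborel. D x (axis i 1)) = 0"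
    using K(1) \<phi>0
    by (intro integral_directional_derivative_eq_0[where K = K and f = "\<lambda>x. f x * \<phi> x"]) simp_all
  moreover have "integrable lborel (\<lambda>x. f x * partial_deriv i \<phi> x)" "integrable lborel (\<lambda>x. g x $ i * \<phi> x)"
    using cont K(1) \<phi>0 d\<phi>0 by (auto intro!: compact_support_continuous_integrable)
  ultimately have "(LINT x|lborel. f x * partial_deriv i \<phi> x) = - (LINT x|lborel. g x $ i * \<phi> x)"
    unfolding D_axis by simp
  moreover have "\<Omega> \<in> sets lebesgue"
    using assms(1) by (simp add: borel_open)
  ultimately show "(LINT x|lebesgue_on \<Omega>. f x * partial_deriv i \<phi> x) =
      - (LINT x|lebesgue_on \<Omega>. g x $ i * \<phi> x)"
    using K(2) \<phi>0 d\<phi>0 cont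
    by (subst (1 2) integral_lebesgue_on_of_support) (auto intro: borel_measurable_continuous_onI)
qed

section \<open>Weighted integrals\<close>

lemma borel_measurable_indicator_lebesgue_on:
  "A \<in> sets lebesgue \<Longrightarrow> (indicator A :: _ \<Rightarrow> real) \<in> borel_measurable (lebesgue_on \<Omega>)"
  by (intro measurable_restrict_space1 borel_measurable_indicator)

lemma borel_imp_measurable_lebesgue_on:
  fixes f :: "'a::euclidean_space \<Rightarrow> real"
  shows "f \<in> borel_measurable borel \<Longrightarrow> f \<in> borel_measurable (lebesgue_on \<Omega>)"
  by (intro measurable_restrict_space1 measurable_completion) simp

lemma weighted_measure_Int_eq:
  assumes "\<Omega> \<in> sets lebesgue"
  shows "weighted_measure w (A \<inter> \<Omega>) = (\<integral>\<^sup>+x. ennreal (indicator A x * w x) \<partial>lebesgue_on \<Omega>)"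
  unfolding weighted_measure_def using assms
  by (auto simp: nn_integral_restrict_space indicator_def intro!: nn_integral_cong)

lemma finite_weighted_measure:
  assumes "weight \<Omega> w" "\<Omega> \<in> sets lebesgue" "A \<in> sets lebesgue" "weighted_measure w (A \<inter> \<Omega>) < \<infinity>"
  shows "integrable (lebesgue_on \<Omega>) (\<lambda>x. indicator A x * w x)"
    and "weighted_measure w (A \<inter> \<Omega>) = ennreal (LINT x|lebesgue_on \<Omega>. indicator A x * w x)"
    and "0 \<le> (LINT x|lebesgue_on \<Omega>. indicator A x * w x)"
proof -
  have nonneg: "AE x in lebesgue_on \<Omega>. 0 \<le> indicator A x * w x"
    using assms(1) unfolding weight_def by (auto elim: eventually_mono)
  show int: "integrable (lebesgue_on \<Omega>) (\<lambda>x. indicator A x * w x)"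
  proof (rule integrableI_nonneg[OF _ nonneg])
    show "(\<lambda>x. indicator A x * w x) \<in> borel_measurable (lebesgue_on \<Omega>)"
      using assms(1,3) borel_measurable_indicator_lebesgue_on unfolding weight_def
      by (intro borel_measurable_times) auto
  qed (use assms(4) weighted_measure_Int_eq[OF assms(2)] in simp)
  show "weighted_measure w (A \<inter> \<Omega>) = ennreal (LINT x|lebesgue_on \<Omega>. indicator A x * w x)"
    unfolding weighted_measure_Int_eq[OF assms(2)] by (rule nn_integral_eq_integral[OF int nonneg])
  show "0 \<le> (LINT x|lebesgue_on \<Omega>. indicator A x * w x)"
    by (rule integral_nonneg_AE[OF nonneg])
qed

lemma weighted_measure_diff_add:
  assumes "weight \<Omega> w" "\<Omega> \<in> sets lebesgue" "A \<in> sets lebesgue" "B \<in> sets lebesgue" "A \<subseteq> B"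
  shows "weighted_measure w (B \<inter> \<Omega>) = weighted_measure w (A \<inter> \<Omega>) + weighted_measure w ((B - A) \<inter> \<Omega>)"
proof -
  have [measurable]: "(\<lambda>x. ennreal (indicator C x * w x)) \<in> borel_measurable (lebesgue_on \<Omega>)"
    if "C \<in> sets lebesgue" for C
    using assms(1) borel_measurable_indicator_lebesgue_on[OF that] unfolding weight_def
    by (intro measurable_compose[OF _ measurable_ennreal] borel_measurable_times) auto
  have "(\<integral>\<^sup>+x. ennreal (indicator B x * w x) \<partial>lebesgue_on \<Omega>) =
        (\<integral>\<^sup>+x. ennreal (indicator A x * w x) + ennreal (indicator (B - A) x * w x) \<partial>lebesgue_on \<Omega>)"
    using assms(5) by (intro nn_integral_cong) (auto simp: indicator_def)
  also have "\<dots> = (\<integral>\<^sup>+x. ennreal (indicator A x * w x) \<partial>lebesgue_on \<Omega>) +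
        (\<integral>\<^sup>+x. ennreal (indicator (B - A) x * w x) \<partial>lebesgue_on \<Omega>)"
    using assms(3,4) by (intro nn_integral_add) auto
  finally show ?thesis
    unfolding weighted_measure_Int_eq[OF assms(2)] .
qed

text \<open>The energies of the cutoff are estimated through this comparison: both \<open>\<bar>u\<bar>\<^sup>p\<close> and \<open>\<bar>\<nabla>u\<bar>\<^sup>p\<close> are
bounded by constants and vanish outside a set \<open>A\<close> of finite weighted measure.\<close>

lemma weighted_integral_le:
  assumes "weight \<Omega> w" "integrable (lebesgue_on \<Omega>) (\<lambda>x. indicator A x * w x)"
    and "F \<in> borel_measurable (lebesgue_on \<Omega>)" "\<And>x. 0 \<le> F x" "\<And>x. F x \<le> B * indicator A x"
  shows "integrable (lebesgue_on \<Omega>) (\<lambda>x. F x * w x)"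
    and "(LINT x|lebesgue_on \<Omega>. F x * w x) \<le> B * (LINT x|lebesgue_on \<Omega>. indicator A x * w x)"
proof -
  have le: "AE x in lebesgue_on \<Omega>. 0 \<le> F x * w x \<and> F x * w x \<le> B * (indicator A x * w x)"
    using assms(1) unfolding weight_def
  proof (elim conjE eventually_mono)
    fix x assume "0 < w x"
    then show "0 \<le> F x * w x \<and> F x * w x \<le> B * (indicator A x * w x)"
      using assms(4)[of x] mult_right_mono[OF assms(5)[of x], of "w x"] by (simp add: mult.assoc)
  qed
  have bound: "integrable (lebesgue_on \<Omega>) (\<lambda>x. B * (indicator A x * w x))"
    using assms(2) by simp
  show int: "integrable (lebesgue_on \<Omega>) (\<lambda>x. F x * w x)"
  proof (rule Bochner_Integration.integrable_bound[OF bound])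
    show "(\<lambda>x. F x * w x) \<in> borel_measurable (lebesgue_on \<Omega>)"
      using assms(1,3) unfolding weight_def by auto
    show "AE x in lebesgue_on \<Omega>. norm (F x * w x) \<le> norm (B * (indicator A x * w x))"
      using le by eventually_elim (simp only: real_norm_def abs_of_nonneg abs_le_iff, linarith)
  qed
  have "(LINT x|lebesgue_on \<Omega>. F x * w x) \<le> (LINT x|lebesgue_on \<Omega>. B * (indicator A x * w x))"
    using le by (intro integral_mono_AE int bound) (auto elim: eventually_mono)
  then show "(LINT x|lebesgue_on \<Omega>. F x * w x) \<le> B * (LINT x|lebesgue_on \<Omega>. indicator A x * w x)"
    by simp
qed

text \<open>A crude substitute for the triangle inequality in \<open>L\<^sup>p\<close>. It holds pointwise, hence also after
restriction to a subset, and constants are immaterial for the argument.\<close>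

lemma powr_abs_add_le:
  fixes a b p :: real
  assumes "0 \<le> p"
  shows "\<bar>a + b\<bar> powr p \<le> 2 powr p * (\<bar>a\<bar> powr p + \<bar>b\<bar> powr p)"
proof -
  have "\<bar>a + b\<bar> powr p \<le> (2 * max \<bar>a\<bar> \<bar>b\<bar>) powr p"
    using assms by (intro powr_mono2) auto
  also have "\<dots> = 2 powr p * max \<bar>a\<bar> \<bar>b\<bar> powr p"
    by (simp add: powr_mult)
  also have "\<dots> \<le> 2 powr p * (\<bar>a\<bar> powr p + \<bar>b\<bar> powr p)"
    by (intro mult_left_mono) (auto simp: max_def)
  finally show ?thesis .
qed

lemma Lp_space_diff:
  assumes "weight \<Omega> w" "0 \<le> p" "u \<in> Lp_space \<Omega> p w" "v \<in> Lp_space \<Omega> p w"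
  shows "(\<lambda>x. u x - v x) \<in> Lp_space \<Omega> p w"
proof -
  have [measurable]: "u \<in> borel_measurable (lebesgue_on \<Omega>)" "v \<in> borel_measurable (lebesgue_on \<Omega>)"
    "w \<in> borel_measurable (lebesgue_on \<Omega>)"
    using assms unfolding Lp_space_def weight_def by auto
  have "integrable (lebesgue_on \<Omega>) (\<lambda>x. 2 powr p * (\<bar>u x\<bar> powr p * w x + \<bar>v x\<bar> powr p * w x))"
    using assms(3,4) unfolding Lp_space_def by simp
  then have "integrable (lebesgue_on \<Omega>) (\<lambda>x. \<bar>u x - v x\<bar> powr p * w x)"
  proof (rule Bochner_Integration.integrable_bound)
    show "AE x in lebesgue_on \<Omega>. norm (\<bar>u x - v x\<bar> powr p * w x)
        \<le> norm (2 powr p * (\<bar>u x\<bar> powr p * w x + \<bar>v x\<bar> powr p * w x))"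
      using assms(1) unfolding weight_def
    proof (elim conjE eventually_mono)
      fix x assume "0 < w x"
      then show "norm (\<bar>u x - v x\<bar> powr p * w x)
          \<le> norm (2 powr p * (\<bar>u x\<bar> powr p * w x + \<bar>v x\<bar> powr p * w x))"
        using mult_right_mono[OF powr_abs_add_le[OF assms(2), of "u x" "- v x"], of "w x"]
        by (simp add: distrib_left distrib_right mult.assoc)
    qed
  qed measurable
  then show ?thesis
    unfolding Lp_space_def by simp
qed

text \<open>Neighbouring cubes of a tesselation share boundary points, so disjointness is available only for
their interiors. Passing to interiors costs nothing, as the boundary of a convex set is null.\<close>

lemma AE_indicator_interior_eq:
  fixes S :: "'a::euclidean_space set"
  assumes "convex S" "closed S" "\<Omega> \<in> sets lebesgue"
  shows "AE x in lebesgue_on \<Omega>. indicator (interior S) x = (indicator S x :: real)"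
proof -
  have "AE x in lebesgue. x \<notin> frontier S"
    using negligible_convex_frontier[OF assms(1)] by (simp add: negligible_iff_null_sets AE_not_in)
  then have "AE x in lebesgue. x \<in> \<Omega> \<longrightarrow> indicator (interior S) x = (indicator S x :: real)"
    by eventually_elim
      (use interior_subset[of S] assms(2) in \<open>auto simp: frontier_def indicator_def closure_closed\<close>)
  then show ?thesis
    using assms(3) by (simp add: AE_restrict_space_iff)
qed

section \<open>Fat cubes contradict compactness\<close>

text \<open>The cutoff of \<open>H\<close> equals \<open>1\<close> on \<open>H\<close> and lives on the enlarged cube \<open>P\<close>. Scaled by \<open>m\<close> to the
power \<open>-1/p\<close>, where \<open>m\<close> is the mass of \<open>H\<close>, it has energy \<open>1\<close> over \<open>H\<close>, and its total energy is at
most \<open>1 + (4/h)\<^sup>p\<close> times the ratio of the mass of \<open>P\<close> to \<open>m\<close>. Fatness bounds this ratio by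
\<open>1 + 1/\<lambda>\<close>; finite and positive \<open>m\<close>, needed for the scaling, comes from finite mass and from
fatness.\<close>

lemma fat_cube_normalized_cutoff:
  fixes Q :: "real^'n^'n"
  assumes "open \<Omega>" "1 \<le> p" "weight \<Omega> w" "0 < lam" "0 < h" "orthogonal_matrix Q"
    and H: "H = cube c Q h"
    and fin: "weighted_measure w (H \<inter> \<Omega>) < \<infinity>" and fat: "fat_cube \<Omega> lam w H"
  obtains u N where "u \<in> sobolev_space \<Omega> p w" "has_sobolev_norm \<Omega> p w u N"
    "N \<le> ((1 + 1 / lam) * (1 + (4 / h) powr p)) powr (1 / p)"
    "(LINT x|lebesgue_on \<Omega>. indicator (interior H) x * (\<bar>u x\<bar> powr p * w x)) = 1"
proof -
  let ?L = "lebesgue_on \<Omega>"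
  define P where "P = cube c Q (3 * h)"
  have \<Omega>: "\<Omega> \<in> sets lebesgue"
    using assms(1) by (simp add: borel_open)
  have Hc: "convex H" "closed H" "compact H"
    using H compact_cube convex_cube compact_imp_closed by blast+
  have "c + Q *v 0 \<in> H"
    unfolding H cube_def using assms(5) by (intro CollectI exI[of _ 0]) simp
  then have Hne: "H \<noteq> {}" by blast
  have HP: "H \<subseteq> P"
    unfolding H P_def using cube_nbhd_contains_collar[OF assms(6)] assms(5) by fastforce
  have meas: "H \<in> sets lebesgue" "P \<in> sets lebesgue" "P - H \<in> sets lebesgue"
    unfolding H P_def by (simp_all add: compact_cube fmeasurableD lmeasurable_compact sets.Diff)
  have fringe: "fringe H = P - H"
    unfolding fringe_def H P_def using cube_nbhd_cube[OF assms(5,6)] by simp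
  have fat': "ennreal lam * weighted_measure w ((P - H) \<inter> \<Omega>) < weighted_measure w (H \<inter> \<Omega>)"
    using fat unfolding fat_cube_def fringe .
  \<comment> \<open>With \<open>\<lambda> > 0\<close>, a fringe of infinite mass would force the mass of \<open>H\<close> to be infinite.\<close>
  have finF: "weighted_measure w ((P - H) \<inter> \<Omega>) < \<infinity>"
  proof (rule ccontr)
    assume "\<not> ?thesis"
    then have "ennreal lam * weighted_measure w ((P - H) \<inter> \<Omega>) = \<infinity>"
      using assms(4) by (simp add: ennreal_mult_top less_top[symmetric])
    then show False using fat' by simp
  qed
  note split = weighted_measure_diff_add[OF assms(3) \<Omega> meas(1,2) HP]
  have finP: "weighted_measure w (P \<inter> \<Omega>) < \<infinity>"
    unfolding split using fin finF by simp
  define m where "m = (LINT x|?L. indicator H x * w x)"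
  define f where "f = (LINT x|?L. indicator (P - H) x * w x)"
  define n where "n = (LINT x|?L. indicator P x * w x)"
  note mH = finite_weighted_measure[OF assms(3) \<Omega> meas(1) fin, folded m_def]
  note mF = finite_weighted_measure[OF assms(3) \<Omega> meas(3) finF, folded f_def]
  note mP = finite_weighted_measure[OF assms(3) \<Omega> meas(2) finP, folded n_def]
  have n_eq: "n = m + f"
    using split mH(3) mF(3) mP(3) unfolding mH(2) mF(2) mP(2)
    by (simp add: ennreal_plus[symmetric] del: ennreal_plus)
  have fm: "lam * f < m"
    using fat' mH(3) mF(3) assms(4) unfolding mH(2) mF(2)
    by (simp add: ennreal_mult[symmetric] ennreal_less_iff)
  have m_pos: "0 < m"
    using fm mF(3) assms(4) by (smt (verit) mult_nonneg_nonneg)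
  have n_le: "n / m \<le> 1 + 1 / lam"
    unfolding n_eq using fm m_pos assms(4) by (simp add: field_simps)
  define a where "a = m powr (- 1 / p)"
  have a: "0 < a" "a powr p = 1 / m"
    using m_pos assms(2) unfolding a_def powr_powr by (simp_all add: powr_minus_divide)
  define u where "u = (\<lambda>x. a * cutoff H h x)"
  define g where "g = (\<lambda>x. a *\<^sub>R cutoff_gradient H h x)"
  have deriv: "(u has_derivative (\<lambda>v. g x \<bullet> v)) (at x)" for x
    unfolding u_def g_def
    using has_derivative_mult_right[OF cutoff_has_derivative[OF Hc(1,2) Hne], of a h x] by simp
  have cont_g: "continuous_on UNIV g"
    unfolding g_def by (intro continuous_intros continuous_on_cutoff_gradient Hc Hne)
  have cont_u: "continuous_on UNIV u"
    using deriv by (meson has_derivative_continuous continuous_at_imp_continuous_on)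
  have weak: "has_weak_gradient \<Omega> u g"
    by (rule has_weak_gradient_of_C1[OF assms(1) deriv cont_g])
  have [measurable]: "u \<in> borel_measurable borel" "g \<in> borel_measurable borel"
    using cont_u cont_g by (auto intro: borel_measurable_continuous_onI)
  have outside: "cutoff H h x = 0" "cutoff_gradient H h x = 0" if "x \<notin> P" for x
  proof -
    have "h < dist x (closest_point H x)"
      using that cube_nbhd_contains_collar[OF assms(6), of "closest_point H x" c h x]
        closest_point_in_set[OF Hc(2) Hne, of x] unfolding P_def H by force
    from cutoff_support[OF assms(5) this]
    show "cutoff H h x = 0" "cutoff_gradient H h x = 0" .
  qed
  have u_powr: "\<bar>u x\<bar> powr p = 1 / m * cutoff H h x powr p" for x
    using a cutoff_range[of H h x] by (simp add: u_def abs_mult powr_mult)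
  have u_le: "\<bar>u x\<bar> powr p \<le> 1 / m * indicator P x" for x
    using outside(1)[of x] cutoff_range[of H h x] m_pos assms(2) unfolding u_powr
    by (cases "x \<in> P") (auto simp: divide_right_mono powr_le1)
  have g_le: "norm (g x) powr p \<le> (4 / h) powr p / m * indicator P x" for x
  proof (cases "x \<in> P")
    case True
    have "norm (g x) powr p = 1 / m * norm (cutoff_gradient H h x) powr p"
      using a by (simp add: g_def powr_mult)
    also have "\<dots> \<le> 1 / m * (4 / h) powr p"
      using norm_cutoff_gradient_le[OF assms(5)] m_pos assms(2)
      by (intro mult_left_mono powr_mono2) auto
    finally show ?thesis using True by simp
  next
    case False
    then show ?thesis by (simp add: g_def outside(2))
  qed
  have gi_le: "\<bar>g x $ i\<bar> powr p \<le> (4 / h) powr p / m * indicator P x" for x i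
    using powr_mono2[OF _ _ component_le_norm_cart[of "g x" i], of p] g_le[of x] assms(2) by simp
  have [measurable]: "(\<lambda>x. g x $ i) \<in> borel_measurable borel" for i
    using cont_g by (intro borel_measurable_continuous_onI continuous_intros)
  have "(\<lambda>x. \<bar>u x\<bar> powr p) \<in> borel_measurable borel" "(\<lambda>x. norm (g x) powr p) \<in> borel_measurable borel"
    "\<And>i. (\<lambda>x. \<bar>g x $ i\<bar> powr p) \<in> borel_measurable borel"
    by measurable
  then have measu: "u \<in> borel_measurable ?L" "(\<lambda>x. \<bar>u x\<bar> powr p) \<in> borel_measurable ?L"
      "(\<lambda>x. norm (g x) powr p) \<in> borel_measurable ?L"
    and measg: "\<And>i. (\<lambda>x. g x $ i) \<in> borel_measurable ?L"
      "\<And>i. (\<lambda>x. \<bar>g x $ i\<bar> powr p) \<in> borel_measurable ?L"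
    by (simp_all add: borel_imp_measurable_lebesgue_on)
  note int_u = weighted_integral_le[OF assms(3) mP(1) measu(2) powr_ge_zero u_le, folded n_def]
  note int_g = weighted_integral_le[OF assms(3) mP(1) measu(3) powr_ge_zero g_le, folded n_def]
  note int_gi = weighted_integral_le[OF assms(3) mP(1) measg(2) powr_ge_zero gi_le, folded n_def]
  have sob: "u \<in> sobolev_space \<Omega> p w"
    unfolding sobolev_space_def Lp_space_def using weak int_u(1) int_gi(1) measu(1) measg(1) by blast
  let ?I = "(LINT x|?L. \<bar>u x\<bar> powr p * w x) + (LINT x|?L. norm (g x) powr p * w x)"
  have norm: "has_sobolev_norm \<Omega> p w u (?I powr (1 / p))"
    unfolding has_sobolev_norm_def using weak by blast
  have "0 \<le> ?I"
    using assms(3) unfolding weight_def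
    by (intro add_nonneg_nonneg integral_nonneg_AE) (auto elim: eventually_mono)
  moreover have "?I \<le> (n / m) * (1 + (4 / h) powr p)"
    using int_u(2) int_g(2) by (simp add: algebra_simps)
  moreover have "\<dots> \<le> (1 + 1 / lam) * (1 + (4 / h) powr p)"
    using n_le by (intro mult_right_mono) auto
  ultimately have norm_le: "?I powr (1 / p) \<le> ((1 + 1 / lam) * (1 + (4 / h) powr p)) powr (1 / p)"
    using assms(2) by (intro powr_mono2) auto
  have "(LINT x|?L. indicator (interior H) x * (\<bar>u x\<bar> powr p * w x)) =
      (LINT x|?L. 1 / m * (indicator H x * w x))"
  proof (rule integral_cong_AE)
    have [measurable]: "w \<in> borel_measurable ?L"
      using assms(3) unfolding weight_def by blast
    have ind [measurable]: "(indicator H :: _ \<Rightarrow> real) \<in> borel_measurable ?L"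
        "(indicator (interior H) :: _ \<Rightarrow> real) \<in> borel_measurable ?L"
      using meas(1) by (auto intro!: borel_measurable_indicator_lebesgue_on simp: borel_open)
    note measu[measurable]
    show "(\<lambda>x. indicator (interior H) x * (\<bar>u x\<bar> powr p * w x)) \<in> borel_measurable ?L"
      "(\<lambda>x. 1 / m * (indicator H x * w x)) \<in> borel_measurable ?L"
      by measurable
    show "AE x in ?L. indicator (interior H) x * (\<bar>u x\<bar> powr p * w x) = 1 / m * (indicator H x * w x)"
      using AE_indicator_interior_eq[OF Hc(1,2) \<Omega>]
    proof eventually_elim
      case (elim x)
      then show ?case
        unfolding elim u_powr by (cases "x \<in> H") (simp_all add: cutoff_eq_1)
    qed
  qed
  also have "\<dots> = 1"
    using m_pos by (simp add: m_def[symmetric])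
  finally have mass: "(LINT x|?L. indicator (interior H) x * (\<bar>u x\<bar> powr p * w x)) = 1" .
  show thesis
    by (rule that[OF sob norm norm_le mass])
qed

text \<open>Suppose \<open>u\<^sub>k \<rightarrow> v\<close> in \<open>L\<^sup>p(\<Omega>,w)\<close> along a subsequence. On \<open>A\<^sub>k\<close> the function \<open>u\<^sub>k\<close> has energy \<open>1\<close>, which
is at most \<open>2\<^sup>p\<close> times the sum of the energies of \<open>u\<^sub>k - v\<close> and of \<open>v\<close> over \<open>A\<^sub>k\<close>. The first term
tends to zero by convergence, the second because a fixed integrable function puts vanishing mass on
disjoint sets. The comparison is with the limit \<open>v\<close>, and not with other members of the sequence,
because the supports of the \<open>u\<^sub>k\<close> may overlap.\<close>

lemma compact_embedding_no_disjoint_bumps: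
  fixes A :: "nat \<Rightarrow> (real^'n) set"
  assumes "0 < p" "weight \<Omega> w" "compact_sobolev_embedding \<Omega> p w"
    and A: "\<And>k. A k \<in> sets lebesgue" "\<And>j k. j \<noteq> k \<Longrightarrow> A j \<inter> A k = {}"
    and u: "\<And>k. u k \<in> sobolev_space \<Omega> p w" "\<And>k. \<exists>N\<le>M. has_sobolev_norm \<Omega> p w (u k) N"
    and mass: "\<And>k. (LINT x|lebesgue_on \<Omega>. indicator (A k) x * (\<bar>u k x\<bar> powr p * w x)) = 1"
  shows False
proof -
  let ?L = "lebesgue_on \<Omega>"
  have "\<forall>k. u k \<in> sobolev_space \<Omega> p w \<and> (\<exists>N\<le>M. has_sobolev_norm \<Omega> p w (u k) N)"
    using u by simp
  then have "\<exists>v\<in>Lp_space \<Omega> p w. \<exists>r :: nat \<Rightarrow> nat. strict_mono r \<and>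
      (\<lambda>k. Lp_norm \<Omega> p w (\<lambda>x. u (r k) x - v x)) \<longlonglongrightarrow> 0"
    by (rule assms(3)[unfolded compact_sobolev_embedding_def, THEN spec[of _ u], THEN spec[of _ M], THEN mp])
  then obtain v r where v: "v \<in> Lp_space \<Omega> p w" and r: "strict_mono (r :: nat \<Rightarrow> nat)"
    and lim: "(\<lambda>k. Lp_norm \<Omega> p w (\<lambda>x. u (r k) x - v x)) \<longlonglongrightarrow> 0"
    by blast
  have uL: "u k \<in> Lp_space \<Omega> p w" for k
    using u(1)[of k] by (simp add: sobolev_space_def)
  have w_pos: "AE x in ?L. 0 < w x" and [measurable]: "w \<in> borel_measurable ?L"
    using assms(2) unfolding weight_def by auto
  have int_v: "integrable ?L (\<lambda>x. \<bar>v x\<bar> powr p * w x)" and [measurable]: "v \<in> borel_measurable ?L"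
    using v unfolding Lp_space_def by auto
  have int_u: "integrable ?L (\<lambda>x. \<bar>u k x\<bar> powr p * w x)" for k
    using uL[of k] unfolding Lp_space_def by auto
  have int_d: "integrable ?L (\<lambda>x. \<bar>u k x - v x\<bar> powr p * w x)" for k
    using Lp_space_diff[OF assms(2) less_imp_le[OF assms(1)] uL v, of k] unfolding Lp_space_def by auto
  have [measurable]: "(indicator (A k) :: _ \<Rightarrow> real) \<in> borel_measurable ?L" for k
    using A(1) by (rule borel_measurable_indicator_lebesgue_on)
  have ind_int: "integrable ?L (\<lambda>x. indicator (A k) x * F x)" if "integrable ?L F" for k and F :: "real^'n \<Rightarrow> real"
  proof (rule Bochner_Integration.integrable_bound[OF that])
    have [measurable]: "F \<in> borel_measurable ?L" using that by auto
    show "(\<lambda>x. indicator (A k) x * F x) \<in> borel_measurable ?L" by measurable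
    show "AE x in ?L. norm (indicator (A k) x * F x) \<le> norm (F x)"
      by (auto simp: indicator_def)
  qed
  define d where "d k = (LINT x|?L. \<bar>u (r k) x - v x\<bar> powr p * w x)" for k
  define b where "b k = (LINT x|?L. indicator (A (r k)) x * (\<bar>v x\<bar> powr p * w x))" for k
  have "d \<longlonglongrightarrow> 0"
  proof -
    have "0 \<le> d k" for k
      unfolding d_def using w_pos by (intro integral_nonneg_AE) (auto elim: eventually_mono)
    then have "d k = Lp_norm \<Omega> p w (\<lambda>x. u (r k) x - v x) powr p" for k
      using assms(1) unfolding Lp_norm_def d_def[symmetric] by (simp add: powr_powr)
    moreover have "(\<lambda>k. Lp_norm \<Omega> p w (\<lambda>x. u (r k) x - v x) powr p) \<longlonglongrightarrow> 0"
      by (rule tendsto_zero_powrI[OF lim tendsto_const]) (use assms(1) in \<open>auto simp: Lp_norm_def\<close>)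
    ultimately show ?thesis by presburger
  qed
  moreover have "b \<longlonglongrightarrow> (LINT x|?L. 0)"
    unfolding b_def
  proof (rule integral_dominated_convergence[where w = "\<lambda>x. \<bar>\<bar>v x\<bar> powr p * w x\<bar>"])
    \<comment> \<open>A point lies in at most one of the disjoint sets, so the sequence is eventually zero.\<close>
    show "AE x in ?L. (\<lambda>k. indicator (A (r k)) x * (\<bar>v x\<bar> powr p * w x)) \<longlonglongrightarrow> 0"
    proof (intro AE_I2 tendsto_eventually)
      fix x
      show "\<forall>\<^sub>F k in sequentially. indicator (A (r k)) x * (\<bar>v x\<bar> powr p * w x) = 0"
      proof (cases "\<exists>j. x \<in> A (r j)")
        case True
        then obtain j where j: "x \<in> A (r j)" by blast
        have notin: "x \<notin> A (r k)" if "j < k" for k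
          using j A(2)[of "r j" "r k"] strict_monoD[OF r that] by auto
        show ?thesis
          using eventually_gt_at_top[of j] by eventually_elim (simp add: notin)
      qed auto
    qed
    show "integrable ?L (\<lambda>x. \<bar>\<bar>v x\<bar> powr p * w x\<bar>)"
      using int_v by (rule integrable_abs)
    show "AE x in ?L. norm (indicator (A (r k)) x * (\<bar>v x\<bar> powr p * w x)) \<le> \<bar>\<bar>v x\<bar> powr p * w x\<bar>" for k
      by (auto simp: indicator_def)
  qed measurable
  ultimately have "(\<lambda>k. 2 powr p * (d k + b k)) \<longlonglongrightarrow> 2 powr p * (0 + (LINT x|?L. 0))"
    by (intro tendsto_intros)
  moreover have "1 \<le> 2 powr p * (d k + b k)" for k
  proof -
    have "1 = (LINT x|?L. indicator (A (r k)) x * (\<bar>u (r k) x\<bar> powr p * w x))"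
      by (simp add: mass)
    also have "\<dots> \<le> (LINT x|?L. 2 powr p * (\<bar>u (r k) x - v x\<bar> powr p * w x +
        indicator (A (r k)) x * (\<bar>v x\<bar> powr p * w x)))"
    proof (rule integral_mono_AE)
      show "AE x in ?L. indicator (A (r k)) x * (\<bar>u (r k) x\<bar> powr p * w x) \<le>
          2 powr p * (\<bar>u (r k) x - v x\<bar> powr p * w x + indicator (A (r k)) x * (\<bar>v x\<bar> powr p * w x))"
        using w_pos
      proof eventually_elim
        case (elim x)
        then show ?case
          using mult_right_mono[OF powr_abs_add_le[of p "u (r k) x - v x" "v x"], of "w x"] assms(1)
          by (cases "x \<in> A (r k)") (auto simp: algebra_simps)
      qed
    qed (intro int_u int_v int_d ind_int integrable_mult_right Bochner_Integration.integrable_add)+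
    also have "\<dots> = 2 powr p * (d k + b k)"
      unfolding d_def b_def using int_d int_v ind_int by simp
    finally show ?thesis .
  qed
  ultimately have "1 \<le> 2 powr p * (0 + (LINT x|?L. (0::real)))"
    by (meson LIMSEQ_le_const)
  then show False by simp
qed

theorem theorem3p2:
  fixes \<Omega> :: "(real^'n) set" and w :: "real^'n \<Rightarrow> real" and p :: real
  assumes "open \<Omega>"
    and "1 \<le> p"
    and "admissible_weight \<Omega> p w"
    and "compact_sobolev_embedding \<Omega> p w"
  shows "\<forall>lam>0. \<forall>h>0. \<forall>T :: (real^'n) set set. tesselation h T \<longrightarrow>
           finite {H \<in> T. weighted_measure w (H \<inter> \<Omega>) < \<infinity> \<and> fat_cube \<Omega> lam w H}"
proof (intro allI impI)
  fix lam h :: real and T :: "(real^'n) set set"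
  assume pos: "0 < lam" "0 < h" and T: "tesselation h T"
  let ?S = "{H \<in> T. weighted_measure w (H \<inter> \<Omega>) < \<infinity> \<and> fat_cube \<Omega> lam w H}"
  have w: "weight \<Omega> w"
    using assms(3) by (simp add: admissible_weight_def)
  define M where "M = ((1 + 1 / lam) * (1 + (4 / h) powr p)) powr (1 / p)"
  define good where "good H u \<longleftrightarrow> u \<in> sobolev_space \<Omega> p w \<and> (\<exists>N\<le>M. has_sobolev_norm \<Omega> p w u N) \<and>
    (LINT x|lebesgue_on \<Omega>. indicator (interior H) x * (\<bar>u x\<bar> powr p * w x)) = 1" for H u
  have ex: "\<exists>u. good H u" if S: "H \<in> ?S" for H
  proof -
    obtain c Q where Q: "orthogonal_matrix Q" "H = cube c Q h"
      using T S unfolding tesselation_def by blast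
    have "weighted_measure w (H \<inter> \<Omega>) < \<infinity>" "fat_cube \<Omega> lam w H"
      using S by auto
    from fat_cube_normalized_cutoff[OF assms(1,2) w pos Q this]
    obtain u N where "u \<in> sobolev_space \<Omega> p w" "has_sobolev_norm \<Omega> p w u N" "N \<le> M"
      "(LINT x|lebesgue_on \<Omega>. indicator (interior H) x * (\<bar>u x\<bar> powr p * w x)) = 1"
      unfolding M_def .
    then show ?thesis unfolding good_def by blast
  qed
  show "finite ?S"
  proof (rule ccontr)
    assume "infinite ?S"
    then obtain H :: "nat \<Rightarrow> _" where H: "inj H" "range H \<subseteq> ?S"
      using infinite_countable_subset by blast
    have "\<forall>k. \<exists>u. good (H k) u"
      using ex H(2) by blast
    then obtain u where u: "\<And>k. good (H k) (u k)" by metis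
    have disj: "interior (H j) \<inter> interior (H k) = {}" if "j \<noteq> k" for j k
    proof -
      have "H j \<noteq> H k" "H j \<in> T" "H k \<in> T"
        using that H by (auto dest: injD)
      then show ?thesis
        using T unfolding tesselation_def pairwise_def by blast
    qed
    show False
    proof (rule compact_embedding_no_disjoint_bumps[of p \<Omega> w "\<lambda>k. interior (H k)" u M])
      show "interior (H k) \<in> sets lebesgue" for k
        by (simp add: borel_open)
    qed (use assms(2,4) w u disj in \<open>auto simp: good_def\<close>)
  qed
qed

end
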